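(* Consider a GSWF on three alternatives satisfying the IIA condition. If the distribution of the preferences is an even product distribution $D(\alpha,\beta,\gamma)$ such that the probability of each preference is positive (i.e. $\alpha,\beta,\gamma>0$, $\alpha+\beta+\gamma=1/2$), and the GSWF is neutral and symmetric, then the probability of irrational choice is bounded away from zero, independently of the number of the voters; that is, it is greater than a positive constant depending only on the distribution of the preferences (on $\alpha,\beta,\gamma$), and not on the number $n$ of voters or on the choice functions.
   Context: There are $n$ voters and three alternatives $A,B,C$. Each voter gives a strict linear ordering of the alternatives; a profile is the collection of the $n$ orderings. Voter $i$'s ordering is encoded by $(x_i,y_i,z_i)\in\{0,1\}^3\setminus\{(0,0,0),(1,1,1)\}$, where $x_i=1$ iff voter $i$ prefers $A$ to $B$, $y_i=1$ iff voter $i$ prefers $B$ to $C$, and $z_i=1$ iff voter $i$ prefers $C$ to $A$. A generalized social welfare function (GSWF) assigns to each profile a preference of the society on each of the three pairs of alternatives (not necessarily transitive). It satisfies Independence of Irrelevant Alternatives (IIA) if the society's preference on each pair depends only on the individual preferences on that pair; so it is given by choice functions $f,g,h:\{0,1\}^n\to\{0,1\}$: society prefers $A$ to $B$ iff $f(x)=1$, $B$ to $C$ iff $g(y)=1$, and $C$ to $A$ iff $h(z)=1$. The choice of the society is irrational for a profile if $f(x)=g(y)=h(z)=1$ or $f(x)=g(y)=h(z)=0$ (no linear ordering results), and rational otherwise. Even product distribution $D(\alpha,\beta,\gamma)$ ($\alpha,\beta,\gamma\ge0$, $\alpha+\beta+\gamma=1/2$): the triples $(x_i,y_i,z_i)$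 are independent for different $i$, and for each $i$, $\Pr[(1,1,0)]=\Pr[(0,0,1)]=\alpha$, $\Pr[(0,1,1)]=\Pr[(1,0,0)]=\beta$, $\Pr[(1,0,1)]=\Pr[(0,1,0)]=\gamma$. The GSWF is neutral if it is invariant under permutations of the alternatives (in particular, $f=g=h$ and $f$ is balanced, i.e. has expectation $1/2$ under the uniform measure on $\{0,1\}^n$). It is symmetric if it is invariant under a transitive group of permutations of the voters.
   Formalization: The number of voters is assumed to be at least 2: with a single voter the dictatorship satisfies IIA, is neutral and (trivially) symmetric, yet its probability of irrational choice is 0. *)

theory Defs
  imports "HOL-Probability.Probability" "HOL-Algebra.Sym_Groups"
begin

datatype alternative = Alt_A | Alt_B | Alt_C

text \<open>
  A (not necessarily transitive) preference is a relation on the alternatives, with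
  \<open>(a, b) \<in> R\<close> meaning that \<open>a\<close> is preferred to \<open>b\<close>. Choosing a winner on each of the three
  pairs means that \<open>R\<close> is asymmetric and total; an individual ordering is in addition transitive,
  that is, a strict linear order.
\<close>

type_synonym preference = "alternative rel"

text \<open>The encoding \<open>(x, y, z)\<close> of a preference: \<open>A\<close> over \<open>B\<close>, \<open>B\<close> over \<open>C\<close>, \<open>C\<close> over \<open>A\<close>.\<close>

definition encode :: "preference \<Rightarrow> bool \<times> bool \<times> bool" where
  "encode R = ((Alt_A, Alt_B) \<in> R, (Alt_B, Alt_C) \<in> R, (Alt_C, Alt_A) \<in> R)"

definition decode :: "bool \<times> bool \<times> bool \<Rightarrow> preference" where
  "decode = (\<lambda>(x, y, z).
     {if x then (Alt_A, Alt_B) else (Alt_B, Alt_A),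
      if y then (Alt_B, Alt_C) else (Alt_C, Alt_B),
      if z then (Alt_C, Alt_A) else (Alt_A, Alt_C)})"

lemma all_alternative:
  "(\<forall>a. P a) \<longleftrightarrow> P Alt_A \<and> P Alt_B \<and> P Alt_C"
  by (metis alternative.exhaust)

lemma encode_decode: "encode (decode t) = t"
  by (cases t) (auto simp: encode_def decode_def)

lemma decode_encode:
  assumes "asym R" "total R"
  shows "decode (encode R) = R"
proof -
  have "\<forall>a b. (a, b) \<in> decode (encode R) \<longleftrightarrow> (a, b) \<in> R"
    using assms unfolding asym_iff total_on_def ball_UNIV encode_def decode_def all_alternative
    by auto
  then show ?thesis by auto
qed

lemma strict_linear_order_decode:
  "strict_linear_order (decode (x, y, z)) \<longleftrightarrow> \<not> (x = y \<and> y = z)"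
  unfolding strict_linear_order_on_def trans_def irrefl_def total_on_def ball_UNIV all_alternative
  by (cases x; cases y; cases z) (simp_all add: decode_def)

text \<open>
  Voters are \<open>1, \<dots>, n\<close>. Profiles are extensional (\<open>undefined\<close> off \<open>{1..n}\<close>), so that there is
  exactly one function per collection of \<open>n\<close> orderings.
\<close>

definition profiles :: "nat \<Rightarrow> (nat \<Rightarrow> preference) set" where
  "profiles n = {1..n} \<rightarrow>\<^sub>E {R. strict_linear_order R}"

definition GSWF :: "nat \<Rightarrow> ((nat \<Rightarrow> preference) \<Rightarrow> preference) \<Rightarrow> bool" where
  "GSWF n F \<longleftrightarrow> (\<forall>P \<in> profiles n. asym (F P) \<and> total (F P))"

definition IIA :: "nat \<Rightarrow> ((nat \<Rightarrow> preference) \<Rightarrow> preference) \<Rightarrow> bool" where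
  "IIA n F \<longleftrightarrow>
     (\<forall>P \<in> profiles n. \<forall>Q \<in> profiles n. \<forall>a b.
        (\<forall>i \<in> {1..n}. (a, b) \<in> P i \<longleftrightarrow> (a, b) \<in> Q i) \<longrightarrow>
        ((a, b) \<in> F P \<longleftrightarrow> (a, b) \<in> F Q))"

definition relabel :: "(alternative \<Rightarrow> alternative) \<Rightarrow> preference \<Rightarrow> preference" where
  "relabel \<sigma> R = map_prod \<sigma> \<sigma> ` R"

definition neutral :: "nat \<Rightarrow> ((nat \<Rightarrow> preference) \<Rightarrow> preference) \<Rightarrow> bool" where
  "neutral n F \<longleftrightarrow>
     (\<forall>\<sigma>. bij \<sigma> \<longrightarrow> (\<forall>P \<in> profiles n.
        F (\<lambda>i \<in> {1..n}. relabel \<sigma> (P i)) = relabel \<sigma> (F P)))"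

definition symmetric :: "nat \<Rightarrow> ((nat \<Rightarrow> preference) \<Rightarrow> preference) \<Rightarrow> bool" where
  "symmetric n F \<longleftrightarrow>
     (\<exists>G. subgroup G (sym_group n) \<and>
          (\<forall>i \<in> {1..n}. \<forall>j \<in> {1..n}. \<exists>\<pi> \<in> G. \<pi> i = j) \<and>
          (\<forall>\<pi> \<in> G. \<forall>P \<in> profiles n. F (P \<circ> \<pi>) = F P))"

text \<open>
  The distribution of one voter's triple; it is meaningful only for
  \<open>\<alpha>, \<beta>, \<gamma> \<ge> 0\<close> and \<open>\<alpha> + \<beta> + \<gamma> = 1/2\<close>, as \<^const>\<open>pmf_of_list\<close> is unspecified on ill-formed lists.
\<close>

definition even_triple_pmf :: "real \<Rightarrow> real \<Rightarrow> real \<Rightarrow> (bool \<times> bool \<times> bool) pmf" where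
  "even_triple_pmf \<alpha> \<beta> \<gamma> = pmf_of_list
     [((True, True, False), \<alpha>), ((False, False, True), \<alpha>),
      ((False, True, True), \<beta>), ((True, False, False), \<beta>),
      ((True, False, True), \<gamma>), ((False, True, False), \<gamma>)]"

definition even_product_pmf :: "nat \<Rightarrow> real \<Rightarrow> real \<Rightarrow> real \<Rightarrow> (nat \<Rightarrow> preference) pmf" where
  "even_product_pmf n \<alpha> \<beta> \<gamma> =
     Pi_pmf {1..n} undefined (\<lambda>_. map_pmf decode (even_triple_pmf \<alpha> \<beta> \<gamma>))"

lemma even_triple_pmf_wf:
  fixes \<alpha> \<beta> \<gamma> :: real
  assumes "\<alpha> \<ge> 0" "\<beta> \<ge> 0" "\<gamma> \<ge> 0" "\<alpha> + \<beta> + \<gamma> = 1/2"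
  shows "pmf_of_list_wf
     [((True, True, False), \<alpha>), ((False, False, True), \<alpha>),
      ((False, True, True), \<beta>), ((True, False, False), \<beta>),
      ((True, False, True), \<gamma>), ((False, True, False), \<gamma>)]"
  using assms by (intro pmf_of_list_wfI) auto

lemma set_even_product_pmf:
  assumes "\<alpha> \<ge> 0" "\<beta> \<ge> 0" "\<gamma> \<ge> 0" "\<alpha> + \<beta> + \<gamma> = 1/2"
  shows "set_pmf (even_product_pmf n \<alpha> \<beta> \<gamma>) \<subseteq> profiles n"
proof -
  have "set_pmf (even_triple_pmf \<alpha> \<beta> \<gamma>) \<subseteq> {(x, y, z). \<not> (x = y \<and> y = z)}"
    using set_pmf_of_list[OF even_triple_pmf_wf[OF assms]]
    by (force simp: even_triple_pmf_def)
  then have "decode ` set_pmf (even_triple_pmf \<alpha> \<beta> \<gamma>) \<subseteq> {R. strict_linear_order R}"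
    by (auto simp: strict_linear_order_decode)
  then have "{1..n} \<rightarrow>\<^sub>E decode ` set_pmf (even_triple_pmf \<alpha> \<beta> \<gamma>) \<subseteq> profiles n"
    unfolding profiles_def by (rule PiE_mono)
  moreover have "set_pmf (even_product_pmf n \<alpha> \<beta> \<gamma>) =
      PiE_dflt {1..n} undefined (\<lambda>_. decode ` set_pmf (even_triple_pmf \<alpha> \<beta> \<gamma>))"
    unfolding even_product_pmf_def by (subst set_Pi_pmf) (simp_all add: comp_def)
  moreover have "PiE_dflt {1..n} undefined S = {1..n} \<rightarrow>\<^sub>E S'"
    if "S = (\<lambda>_. S')" for S and S' :: "preference set"
    unfolding that PiE_dflt_def PiE_def extensional_def Pi_def by blast
  ultimately show ?thesis by simp
qed

text \<open>Under IIA, \<open>encode (F P)\<close> is the triple \<open>(f(x), g(y), h(z))\<close> of values of the choice functions.\<close>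

definition irrational :: "preference \<Rightarrow> bool" where
  "irrational R \<longleftrightarrow> encode R = (True, True, True) \<or> encode R = (False, False, False)"

lemma irrational_iff:
  assumes "asym R" "total R"
  shows "irrational R \<longleftrightarrow> \<not> strict_linear_order R"
proof -
  obtain x y z where e: "encode R = (x, y, z)" by (cases "encode R")
  then have "R = decode (x, y, z)" using decode_encode[OF assms] by simp
  then have "strict_linear_order R \<longleftrightarrow> \<not> (x = y \<and> y = z)"
    using strict_linear_order_decode by simp
  then show ?thesis using e by (auto simp: irrational_def)
qed

end

theory Submission
  imports Defs
begin

text \<open>
  Neutrality and IIA give one choice function \<open>f\<close> (with values \<open>\<plusminus>1\<close>) for all three pairs, and the
  three pairs of coordinates \<open>(x\<^sub>i, y\<^sub>i)\<close>, \<open>(y\<^sub>i, z\<^sub>i)\<close>, \<open>(z\<^sub>i, x\<^sub>i)\<close> are unbiased with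
  correlations \<open>r = 4\<alpha> - 1\<close>, \<open>s = 4\<beta> - 1\<close>, \<open>t = 4\<gamma> - 1\<close>. Hence the probability of irrational choice is
  one quarter of the sum over \<open>S\<close> of \<open>c(S)\<^sup>2 (1 + r\<^sup>k + s\<^sup>k + t\<^sup>k)\<close> where \<open>k = |S|\<close>
  and \<open>c(S)\<close> is the Fourier coefficient of \<open>f\<close> at \<open>S\<close>.
  The bracket vanishes for \<open>k = 1\<close>, as \<open>r + s + t = -1\<close>, and is otherwise at least
  \<open>(1 + r)(1 + s)(1 + t) / 2 = 32\<alpha>\<beta>\<gamma>\<close>. By transitivity of the symmetry group all level-one
  coefficients are equal, so the level-one weight is the squared correlation of \<open>f\<close> with the
  normalised sum \<open>T\<close> of \<open>n\<close> random signs. As \<open>T\<close> is not concentrated on \<open>\<plusminus>1\<close>, which its second,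
  fourth and sixth moments show when \<open>n \<ge> 2\<close>, this weight is at most \<open>35/36\<close>.
\<close>

section \<open>Fourier-Walsh analysis on the subsets of a finite set\<close>

definition spin :: "bool \<Rightarrow> real" where
  "spin b = (if b then 1 else -1)"

text \<open>A subset \<open>X\<close> stands for a point of the discrete cube, with sign +1 on
  \<open>X\<close> and -1 off \<open>X\<close>; \<open>walsh S\<close> is then the character of the
  cube indexed by \<open>S\<close>.\<close>

definition walsh :: "'a set \<Rightarrow> 'a set \<Rightarrow> real" where
  "walsh S X = (\<Prod>i\<in>S. spin (i \<in> X))"

definition fourier :: "'a set \<Rightarrow> ('a set \<Rightarrow> real) \<Rightarrow> 'a set \<Rightarrow> real" where
  "fourier A f S = (\<Sum>X\<in>Pow A. f X * walsh S X) / 2 ^ card A"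

definition spin_sum :: "'a set \<Rightarrow> 'a set \<Rightarrow> real" where
  "spin_sum A X = (\<Sum>i\<in>A. spin (i \<in> X))"

lemma spin_simps [simp]: "spin True = 1" "spin False = -1"
  by (simp_all add: spin_def)

lemma spin_mult_spin: "spin a * spin b = (if a = b then 1 else -1)"
  by (simp add: spin_def)

text \<open>Summing over all \<open>S\<close> expands a product over the coordinates, and a
  coordinate on which \<open>X\<close> and \<open>Y\<close> differ contributes the factor -1 + 1 =
  0.\<close>

lemma sum_walsh_mult:
  assumes "finite A" "X \<subseteq> A" "Y \<subseteq> A"
  shows "(\<Sum>S\<in>Pow A. walsh S X * walsh S Y) = (if X = Y then 2 ^ card A else 0)"
proof -
  have "(\<Sum>S\<in>Pow A. walsh S X * walsh S Y)
      = (\<Prod>i\<in>A. spin (i \<in> X) * spin (i \<in> Y) + 1)"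
    by (subst prod_add[OF assms(1)]) (simp add: walsh_def prod.distrib)
  also have "\<dots> = (if X = Y then 2 ^ card A else 0)"
  proof (cases "X = Y")
    case True
    then show ?thesis by (simp add: spin_mult_spin)
  next
    case False
    then obtain i where "i \<in> A" "(i \<in> X) \<noteq> (i \<in> Y)"
      using assms by blast
    then have "(\<Prod>i\<in>A. spin (i \<in> X) * spin (i \<in> Y) + 1) = 0"
      using assms(1) by (intro prod_zero) (auto simp: spin_mult_spin)
    then show ?thesis using False by simp
  qed
  finally show ?thesis .
qed

lemma fourier_expansion:
  assumes "finite A" "X \<subseteq> A"
  shows "(\<Sum>S\<in>Pow A. fourier A f S * walsh S X) = f X"
proof -
  have "(\<Sum>S\<in>Pow A. fourier A f S * walsh S X)
      = (\<Sum>S\<in>Pow A. \<Sum>Y\<in>Pow A. f Y * (walsh S Y * walsh S X)) / 2 ^ card A"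
    by (simp add: fourier_def sum_distrib_left sum_distrib_right sum_divide_distrib mult_ac)
  also have "(\<Sum>S\<in>Pow A. \<Sum>Y\<in>Pow A. f Y * (walsh S Y * walsh S X))
      = (\<Sum>Y\<in>Pow A. f Y * (\<Sum>S\<in>Pow A. walsh S Y * walsh S X))"
    by (subst sum.swap) (simp add: sum_distrib_left)
  also have "\<dots> = (\<Sum>Y\<in>Pow A. if Y = X then f X * 2 ^ card A else 0)"
    using assms by (intro sum.cong) (auto simp: sum_walsh_mult)
  also have "\<dots> = f X * 2 ^ card A"
    using assms by (simp add: sum.delta)
  finally show ?thesis by simp
qed

text \<open>One factor of each square is expanded by definition; after swapping the sums, the other
  factor recombines into \<open>f X\<close> by \<open>fourier_expansion\<close>.\<close>

lemma parseval:
  assumes "finite A"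
  shows "(\<Sum>S\<in>Pow A. (fourier A f S)\<^sup>2) = (\<Sum>X\<in>Pow A. (f X)\<^sup>2) / 2 ^ card A"
proof -
  have "(\<Sum>S\<in>Pow A. (fourier A f S)\<^sup>2)
      = (\<Sum>S\<in>Pow A. \<Sum>X\<in>Pow A. f X * (fourier A f S * walsh S X)) / 2 ^ card A"
    by (subst power2_eq_square, subst (2) fourier_def)
       (simp add: sum_distrib_left sum_divide_distrib mult_ac)
  also have "(\<Sum>S\<in>Pow A. \<Sum>X\<in>Pow A. f X * (fourier A f S * walsh S X))
      = (\<Sum>X\<in>Pow A. f X * (\<Sum>S\<in>Pow A. fourier A f S * walsh S X))"
    by (subst sum.swap) (simp add: sum_distrib_left)
  also have "\<dots> = (\<Sum>X\<in>Pow A. (f X)\<^sup>2)"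
    using assms by (intro sum.cong) (auto simp: fourier_expansion power2_eq_square)
  finally show ?thesis .
qed

lemma parseval_sign:
  assumes "finite A" "\<And>X. X \<subseteq> A \<Longrightarrow> f X = 1 \<or> f X = -1"
  shows "(\<Sum>S\<in>Pow A. (fourier A f S)\<^sup>2) = 1"
proof -
  have "(\<Sum>X\<in>Pow A. (f X)\<^sup>2) = (\<Sum>X\<in>Pow A. 1)"
    using assms(2) by (intro sum.cong) (auto simp: power2_eq_1_iff)
  then show ?thesis
    using assms(1) by (simp add: parseval card_Pow)
qed

section \<open>Moments of a sum of signs and its correlation with a sign-valued function\<close>

lemma sum_Pow_insert:
  fixes g :: "'a set \<Rightarrow> real"
  assumes "finite A" "a \<notin> A"
  shows "sum g (Pow (insert a A)) = (\<Sum>X\<in>Pow A. g X + g (insert a X))"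
proof -
  have "inj_on (insert a) (Pow A)" "Pow A \<inter> insert a ` Pow A = {}"
    using assms(2) by (auto simp: inj_on_def)
  then show ?thesis
    using assms(1) by (simp add: Pow_insert sum.union_disjoint sum.reindex sum.distrib)
qed

lemma spin_sum_insert:
  assumes "finite A" "a \<notin> A" "X \<subseteq> A"
  shows "spin_sum (insert a A) X = spin_sum A X - 1"
    and "spin_sum (insert a A) (insert a X) = spin_sum A X + 1"
proof -
  have "a \<notin> X" using assms by blast
  then show "spin_sum (insert a A) X = spin_sum A X - 1"
    using assms by (simp add: spin_sum_def)
  have "(\<Sum>i\<in>A. spin (i \<in> insert a X)) = (\<Sum>i\<in>A. spin (i \<in> X))"
    using assms by (intro sum.cong arg_cong[where f = spin]) auto
  then show "spin_sum (insert a A) (insert a X) = spin_sum A X + 1"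
    using assms by (simp add: spin_sum_def)
qed

text \<open>A new coordinate shifts the sum by -1 or +1. For even powers the odd terms of the two
  shifts cancel, which gives a recursion for each even moment in terms of the even moments up to the
  same order.\<close>

lemma sum_Pow_insert_spin_sum:
  fixes g :: "real \<Rightarrow> real"
  assumes "finite A" "a \<notin> A"
  shows "(\<Sum>X\<in>Pow (insert a A). g (spin_sum (insert a A) X))
       = (\<Sum>X\<in>Pow A. g (spin_sum A X - 1) + g (spin_sum A X + 1))"
  using assms by (simp add: sum_Pow_insert) (intro sum.cong, auto simp: spin_sum_insert)

lemma spin_sum_moment2:
  assumes "finite A"
  shows "(\<Sum>X\<in>Pow A. (spin_sum A X)\<^sup>2) = 2 ^ card A * real (card A)"
  using assms
proof (induction A rule: finite_induct)
  case empty
  then show ?case by (simp add: spin_sum_def)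
next
  case (insert a A)
  have "(s - 1)\<^sup>2 + (s + 1)\<^sup>2 = 2 * s\<^sup>2 + 2" for s :: real
    by algebra
  then have "(\<Sum>X\<in>Pow (insert a A). (spin_sum (insert a A) X)\<^sup>2)
      = (\<Sum>X\<in>Pow A. 2 * (spin_sum A X)\<^sup>2 + 2)"
    by (simp only: sum_Pow_insert_spin_sum[OF insert(1,2), where g = "\<lambda>s. s\<^sup>2"])
  also have "\<dots> = 2 * (\<Sum>X\<in>Pow A. (spin_sum A X)\<^sup>2) + 2 * 2 ^ card A"
    using insert by (simp add: sum.distrib card_Pow flip: sum_distrib_left)
  finally show ?case
    using insert by (simp add: algebra_simps)
qed

lemma spin_sum_moment4:
  assumes "finite A"
  shows "(\<Sum>X\<in>Pow A. spin_sum A X ^ 4) = 2 ^ card A * (3 * real (card A) ^ 2 - 2 * real (card A))"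
  using assms
proof (induction A rule: finite_induct)
  case empty
  then show ?case by (simp add: spin_sum_def)
next
  case (insert a A)
  have "(s - 1) ^ 4 + (s + 1) ^ 4 = 2 * s ^ 4 + 12 * s\<^sup>2 + 2" for s :: real
    by algebra
  then have "(\<Sum>X\<in>Pow (insert a A). spin_sum (insert a A) X ^ 4)
      = (\<Sum>X\<in>Pow A. 2 * spin_sum A X ^ 4 + 12 * (spin_sum A X)\<^sup>2 + 2)"
    by (simp only: sum_Pow_insert_spin_sum[OF insert(1,2), where g = "\<lambda>s. s ^ 4"])
  also have "\<dots> = 2 * (\<Sum>X\<in>Pow A. spin_sum A X ^ 4)
      + 12 * (\<Sum>X\<in>Pow A. (spin_sum A X)\<^sup>2) + 2 * 2 ^ card A"
    using insert by (simp add: sum.distrib card_Pow flip: sum_distrib_left)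
  finally show ?case
    unfolding insert.IH spin_sum_moment2[OF insert(1)]
    using insert(1,2) by (simp add: algebra_simps power2_eq_square)
qed

lemma spin_sum_moment6:
  assumes "finite A"
  shows "(\<Sum>X\<in>Pow A. spin_sum A X ^ 6)
       = 2 ^ card A * (15 * real (card A) ^ 3 - 30 * real (card A) ^ 2 + 16 * real (card A))"
  using assms
proof (induction A rule: finite_induct)
  case empty
  then show ?case by (simp add: spin_sum_def)
next
  case (insert a A)
  have "(s - 1) ^ 6 + (s + 1) ^ 6 = 2 * s ^ 6 + 30 * s ^ 4 + 30 * s\<^sup>2 + 2" for s :: real
    by algebra
  then have "(\<Sum>X\<in>Pow (insert a A). spin_sum (insert a A) X ^ 6)
      = (\<Sum>X\<in>Pow A. 2 * spin_sum A X ^ 6 + 30 * spin_sum A X ^ 4 + 30 * (spin_sum A X)\<^sup>2 + 2)"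
    by (simp only: sum_Pow_insert_spin_sum[OF insert(1,2), where g = "\<lambda>s. s ^ 6"])
  also have "\<dots> = 2 * (\<Sum>X\<in>Pow A. spin_sum A X ^ 6) + 30 * (\<Sum>X\<in>Pow A. spin_sum A X ^ 4)
        + 30 * (\<Sum>X\<in>Pow A. (spin_sum A X)\<^sup>2) + 2 * 2 ^ card A"
    using insert by (simp add: sum.distrib card_Pow flip: sum_distrib_left)
  finally show ?case
    unfolding insert.IH spin_sum_moment2[OF insert(1)] spin_sum_moment4[OF insert(1)]
    using insert(1,2) by (simp add: algebra_simps power2_eq_square power3_eq_cube)
qed

text \<open>
  The factor \<open>1/16 - t\<^sup>2/144\<close> keeps the lower bound polynomial in \<open>t\<close>, so that it can be averaged
  by moments. If \<open>\<bar>t\<bar> \<le> 3\<close> then \<open>(t + e)\<^sup>2 \<le> 16\<close>; otherwise the factor is negative.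
\<close>

lemma sq_diff_sign_ge:
  fixes t e :: real
  assumes "e = 1 \<or> e = -1"
  shows "(t - e)\<^sup>2 \<ge> (1/16 - t\<^sup>2/144) * (t\<^sup>2 - 1)\<^sup>2"
proof -
  have *: "(1/16 - t\<^sup>2/144) * (t + e)\<^sup>2 \<le> 1"
  proof (cases "\<bar>t\<bar> \<le> 3")
    case True
    then have "t\<^sup>2 \<le> 3\<^sup>2" by (metis abs_ge_zero power2_abs power_mono)
    moreover have "\<bar>t + e\<bar> \<le> 4" using True assms by auto
    then have "(t + e)\<^sup>2 \<le> 4\<^sup>2" by (metis abs_ge_zero power2_abs power_mono)
    ultimately have "(1/16 - t\<^sup>2/144) * (t + e)\<^sup>2 \<le> (1/16) * 16"
      by (intro mult_mono) auto
    then show ?thesis by simp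
  next
    case False
    then have "3\<^sup>2 \<le> t\<^sup>2" by (metis abs_ge_zero linorder_le_cases power2_abs power_mono zero_le_numeral)
    then have "(1/16 - t\<^sup>2/144) * (t + e)\<^sup>2 \<le> 0"
      by (intro mult_nonpos_nonneg) auto
    then show ?thesis by simp
  qed
  have "(t\<^sup>2 - 1)\<^sup>2 = (t - e)\<^sup>2 * (t + e)\<^sup>2"
    using assms by (auto simp: power2_eq_square algebra_simps)
  then have "(1/16 - t\<^sup>2/144) * (t\<^sup>2 - 1)\<^sup>2 = (t - e)\<^sup>2 * ((1/16 - t\<^sup>2/144) * (t + e)\<^sup>2)"
    by simp
  also have "\<dots> \<le> (t - e)\<^sup>2 * 1"
    using * by (intro mult_left_mono) auto
  finally show ?thesis by simp
qed

text \<open>Since 2et = t^2 + 1 - (t - e)^2 for a sign e, the lower bound of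
  \<open>sq_diff_sign_ge\<close> turns into an upper bound for et by an even polynomial of degree 6
  in t. With t the normalised sum, its average is given by the three moments.\<close>

lemma correlation_spin_sum_le:
  assumes "finite A" "card A \<ge> 2" "\<And>X. X \<subseteq> A \<Longrightarrow> f X = 1 \<or> f X = -1"
  shows "(\<Sum>X\<in>Pow A. f X * spin_sum A X) \<le> 35/36 * sqrt (card A) * 2 ^ card A"
proof -
  define n where "n = real (card A)"
  have n: "n \<ge> 2" using assms(2) by (simp add: n_def)
  have pointwise: "f X * (spin_sum A X / sqrt n)
      \<le> (1/2 - 1/32) + (1/2 + 1/16 + 1/288) / n * (spin_sum A X)\<^sup>2
        + (- 1/32 - 1/144) / n^2 * spin_sum A X ^ 4 + 1/288 / n^3 * spin_sum A X ^ 6"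
    if "X \<subseteq> A" for X
  proof -
    define t where "t = spin_sum A X / sqrt n"
    have t: "t\<^sup>2 = (spin_sum A X)\<^sup>2 / n" using n by (simp add: t_def power_divide)
    have t4: "t ^ 4 = spin_sum A X ^ 4 / n^2"
      using arg_cong[OF t, of "\<lambda>s. s^2"] by (simp add: power_divide)
    have t6: "t ^ 6 = spin_sum A X ^ 6 / n^3"
      using arg_cong[OF t, of "\<lambda>s. s^3"] by (simp add: power_divide)
    have "(t - f X)\<^sup>2 \<ge> (1/16 - t\<^sup>2/144) * (t\<^sup>2 - 1)\<^sup>2"
      using assms(3)[OF that] by (rule sq_diff_sign_ge)
    moreover have "(t - f X)\<^sup>2 = t\<^sup>2 + 1 - 2 * (f X * t)"
      using assms(3)[OF that] by (auto simp: power2_eq_square algebra_simps)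
    moreover have "(1/16 - t\<^sup>2/144) * (t\<^sup>2 - 1)\<^sup>2
        = 1/16 - (1/8 + 1/144) * t\<^sup>2 + (1/16 + 1/72) * t^4 - 1/144 * t^6"
      by (simp add: power2_eq_square algebra_simps power_numeral_reduce)
    ultimately have "f X * t \<le> (1/2 - 1/32) + (1/2 + 1/16 + 1/288) * t\<^sup>2
        + (- 1/32 - 1/144) * t^4 + 1/288 * t^6"
      by (simp add: algebra_simps)
    then show ?thesis unfolding t t4 t6 by (simp add: t_def)
  qed
  have "(\<Sum>X\<in>Pow A. f X * (spin_sum A X / sqrt n))
      \<le> (\<Sum>X\<in>Pow A. (1/2 - 1/32) + (1/2 + 1/16 + 1/288) / n * (spin_sum A X)\<^sup>2
        + (- 1/32 - 1/144) / n^2 * spin_sum A X ^ 4 + 1/288 / n^3 * spin_sum A X ^ 6)"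
    by (intro sum_mono pointwise) auto
  also have "\<dots> = 2 ^ card A * ((1/2 - 1/32) + (1/2 + 1/16 + 1/288) / n * n
        + (- 1/32 - 1/144) / n^2 * (3 * n^2 - 2 * n)
        + 1/288 / n^3 * (15 * n^3 - 30 * n^2 + 16 * n))"
    unfolding sum.distrib sum_distrib_left[symmetric]
      spin_sum_moment2[OF assms(1)] spin_sum_moment4[OF assms(1)] spin_sum_moment6[OF assms(1)]
    using assms(1) by (simp only: n_def sum_constant card_Pow of_nat_power of_nat_numeral) algebra
  also have "(1/2 - 1/32) + (1/2 + 1/16 + 1/288) / n * n
        + (- 1/32 - 1/144) / n^2 * (3 * n^2 - 2 * n)
        + 1/288 / n^3 * (15 * n^3 - 30 * n^2 + 16 * n)
      = 35/36 - (n - 2) / (36 * n^2)"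
    using n by (simp add: field_simps power2_eq_square power3_eq_cube)
  \<comment> \<open>This is where \<open>card A \<ge> 2\<close> is essential: for one voter,
    \<open>f = spin_sum A\<close> has correlation 1.\<close>
  also have "2 ^ card A * (35/36 - (n - 2) / (36 * n^2)) \<le> 2 ^ card A * (35/36)"
    using n by (intro mult_left_mono) auto
  finally have "(\<Sum>X\<in>Pow A. f X * spin_sum A X) / sqrt n \<le> 2 ^ card A * (35/36)"
    by (simp add: sum_divide_distrib)
  then show ?thesis
    using n by (simp add: pos_divide_le_eq n_def mult_ac)
qed

section \<open>Lower bounds for the multipliers 1 + r^k + s^k + t^k\<close>

text \<open>The right-hand side is nondecreasing in \<open>k\<close>, with equality at \<open>k = 2\<close>.\<close>

lemma power_sum_gap:
  fixes a b :: real
  assumes "a \<le> 1" "b \<le> 1" "a + b \<ge> 1" "k \<ge> 2"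
  shows "2 * (1 - a) * (1 - b) \<le> 1 + (a + b - 1) ^ k - a ^ k - b ^ k"
  using assms(4)
proof (induction k rule: dec_induct)
  case base
  show ?case by (simp add: power2_eq_square algebra_simps)
next
  case (step k)
  define t where "t = a + b - 1"
  \<comment> \<open>The increment from k to k + 1 is a^k (1 - a) + b^k (1 - b) - t^k (1 - t). It is
    nonnegative because 0 \<le> t \<le> a, b and 1 - t splits as (1 - a) + (1 - b).\<close>
  have "t ^ k \<le> a ^ k" "t ^ k \<le> b ^ k"
    using assms by (auto simp: t_def intro!: power_mono)
  then have "t ^ k * (1 - a) \<le> a ^ k * (1 - a)" "t ^ k * (1 - b) \<le> b ^ k * (1 - b)"
    using assms by (auto intro!: mult_right_mono)
  then have "t ^ k * ((1 - a) + (1 - b)) \<le> a ^ k * (1 - a) + b ^ k * (1 - b)"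
    unfolding distrib_left by linarith
  moreover have "(1 - a) + (1 - b) = 1 - t" by (simp add: t_def)
  ultimately have "t ^ k * (1 - t) \<le> a ^ k * (1 - a) + b ^ k * (1 - b)"
    by simp
  then have "1 + t ^ k - a ^ k - b ^ k \<le> 1 + t ^ Suc k - a ^ Suc k - b ^ Suc k"
    unfolding right_diff_distrib power_Suc2 by linarith
  then show ?case using step.IH by (simp add: t_def)
qed

text \<open>Here -c = a + b - 1 \<ge> 0, and oddness of k turns -c^k into the term (a + b - 1)^k of
  \<open>power_sum_gap\<close>; the factor 2 there absorbs 1 - c \<le> 2.\<close>

lemma odd_power_sum_gap_negative:
  fixes a b c :: real
  assumes "a \<le> 1" "b \<le> 1" "- 1 \<le> c" "c \<le> 0" "a + b + c = 1" "odd k" "k \<ge> 2"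
  shows "(1 - a) * (1 - b) * (1 - c) \<le> 1 - (a ^ k + b ^ k + c ^ k)"
proof -
  have "c ^ k = - ((a + b - 1) ^ k)"
    using assms(5,6) by (metis add_diff_cancel_left' add_diff_eq diff_diff_eq2 minus_diff_eq power_minus_odd)
  moreover have "2 * (1 - a) * (1 - b) \<le> 1 + (a + b - 1) ^ k - a ^ k - b ^ k"
    using assms by (intro power_sum_gap) auto
  moreover have "(1 - a) * (1 - b) * (1 - c) \<le> 2 * (1 - a) * (1 - b)"
    using mult_left_mono[of "1 - c" 2 "(1 - a) * (1 - b)"] assms
    by (simp only: mult.commute[of _ 2] mult.assoc[of 2, symmetric]) simp
  ultimately show ?thesis by linarith
qed

text \<open>If all three numbers are nonnegative, powers are at most squares, which reduces the
  claim to k = 2. Otherwise a negative one takes the role of c in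
  \<open>odd_power_sum_gap_negative\<close>.\<close>

lemma odd_power_sum_gap:
  fixes a b c :: real
  assumes "\<bar>a\<bar> \<le> 1" "\<bar>b\<bar> \<le> 1" "\<bar>c\<bar> \<le> 1" "a + b + c = 1" "odd k" "k \<ge> 2"
  shows "(1 - a) * (1 - b) * (1 - c) \<le> 1 - (a ^ k + b ^ k + c ^ k)"
proof -
  consider "a \<ge> 0" "b \<ge> 0" "c \<ge> 0" | "a < 0" | "b < 0" | "c < 0" by linarith
  then show ?thesis
  proof cases
    case 1
    have "x ^ k \<le> x\<^sup>2" if "0 \<le> x" "x \<le> 1" for x :: real
      using that assms(6) by (intro power_decreasing)
    then have "a ^ k + b ^ k + c ^ k \<le> a\<^sup>2 + b\<^sup>2 + c\<^sup>2"
      using 1 assms by (intro add_mono) auto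
    moreover have c: "c = 1 - a - b" using assms(4) by simp
    have "1 - (a\<^sup>2 + b\<^sup>2 + c\<^sup>2) - (1 - a) * (1 - b) * (1 - c) = a * b + b * c + c * a + a * b * c"
      unfolding c by algebra
    moreover have "a * b + b * c + c * a + a * b * c \<ge> 0" using 1 by simp
    ultimately show ?thesis by linarith
  next
    case 2
    then show ?thesis using odd_power_sum_gap_negative[of b c a k] assms by (simp add: mult_ac add_ac)
  next
    case 3
    then show ?thesis using odd_power_sum_gap_negative[of c a b k] assms by (simp add: mult_ac add_ac)
  next
    case 4
    then show ?thesis using odd_power_sum_gap_negative[of a b c k] assms by simp
  qed
qed

text \<open>For even k, including 0, the right-hand side is at least 1, while AM-GM and 1 + t \<le>
  2 bound the left-hand side by 1. For odd k, negating r, s, t gives three numbers with sum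
  1.\<close>

lemma noise_multiplier_ge:
  fixes r s t :: real
  assumes "\<bar>r\<bar> \<le> 1" "\<bar>s\<bar> \<le> 1" "\<bar>t\<bar> \<le> 1" "r + s + t = - 1" "k \<noteq> 1"
  shows "(1 + r) * (1 + s) * (1 + t) / 2 \<le> 1 + r ^ k + s ^ k + t ^ k"
proof (cases "even k")
  case True
  have "((1 + r) + (1 + s)) / 2 \<le> 1"
    using assms by simp
  then have "(((1 + r) + (1 + s)) / 2)\<^sup>2 \<le> 1\<^sup>2"
    using assms by (intro power_mono) auto
  moreover have "(1 + r) * (1 + s) \<le> (((1 + r) + (1 + s)) / 2)\<^sup>2"
    using zero_le_power2[of "r - s"] by (simp add: power2_eq_square field_simps)
  ultimately have "(1 + r) * (1 + s) * (1 + t) \<le> 1 * 2"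
    using assms by (intro mult_mono) auto
  moreover have "r ^ k \<ge> 0" "s ^ k \<ge> 0" "t ^ k \<ge> 0"
    using True by (auto intro: zero_le_even_power)
  ultimately show ?thesis by simp
next
  case False
  then have "k \<ge> 2" using assms(5) by (cases k) auto
  then have "(1 + r) * (1 + s) * (1 + t) \<le> 1 + r ^ k + s ^ k + t ^ k"
    using odd_power_sum_gap[of "- r" "- s" "- t" k] False assms by (simp add: power_minus_odd)
  moreover have "0 \<le> (1 + r) * (1 + s) * (1 + t)"
    using assms by (intro mult_nonneg_nonneg) auto
  ultimately show ?thesis by simp
qed

section \<open>Correlated bit vectors under product distributions\<close>

lemma expectation_prod_Pi_pmf_bounded:
  fixes h :: "'a \<Rightarrow> 'b \<Rightarrow> real"
  assumes "finite A" "\<And>i x. \<bar>h i x\<bar> \<le> 1"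
  shows "measure_pmf.expectation (Pi_pmf A d p) (\<lambda>P. \<Prod>i\<in>A. h i (P i))
       = (\<Prod>i\<in>A. measure_pmf.expectation (p i) (h i))"
proof -
  let ?M = "measure_pmf (Pi_pmf A d p)"
  have "prob_space.indep_vars ?M (\<lambda>_. borel) (\<lambda>i P. h i (P i)) A"
    by (rule prob_space.indep_vars_compose2[OF measure_pmf.prob_space_axioms
          indep_vars_Pi_pmf[OF assms(1)]]) simp
  then have "measure_pmf.expectation (Pi_pmf A d p) (\<lambda>P. \<Prod>i\<in>A. h i (P i))
      = (\<Prod>i\<in>A. measure_pmf.expectation (Pi_pmf A d p) (\<lambda>P. h i (P i)))"
    using assms
    by (intro prob_space.indep_vars_lebesgue_integral[OF measure_pmf.prob_space_axioms])
       (auto intro!: measure_pmf.integrable_const_bound[where B = 1])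
  also have "\<dots> = (\<Prod>i\<in>A. measure_pmf.expectation (map_pmf (\<lambda>P. P i) (Pi_pmf A d p)) (h i))"
    by simp
  also have "\<dots> = (\<Prod>i\<in>A. measure_pmf.expectation (p i) (h i))"
    using assms(1) by (intro prod.cong refl) (simp add: Pi_pmf_component del: integral_map_pmf)
  finally show ?thesis .
qed

context
  fixes q :: "'b pmf" and u v :: "'b \<Rightarrow> bool" and r :: real
  assumes mean_u: "measure_pmf.expectation q (\<lambda>x. spin (u x)) = 0"
    and mean_v: "measure_pmf.expectation q (\<lambda>x. spin (v x)) = 0"
    and corr_uv: "measure_pmf.expectation q (\<lambda>x. spin (u x) * spin (v x)) = r"
begin

text \<open>The expectation factorises over the independent voters: a voter in both sets contributes
  r, one in neither contributes 1, and one in exactly one set contributes a mean, which is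
  0.\<close>

lemma expectation_walsh_mult:
  assumes "finite A" "S \<subseteq> A" "T \<subseteq> A"
  shows "measure_pmf.expectation (Pi_pmf A d (\<lambda>_. q))
           (\<lambda>P. walsh S {i \<in> A. u (P i)} * walsh T {i \<in> A. v (P i)})
       = (if S = T then r ^ card S else 0)"
proof -
  define h where "h = (\<lambda>i x. (if i \<in> S then spin (u x) else 1) * (if i \<in> T then spin (v x) else 1))" 
  have walsh: "walsh S {i \<in> A. w (P i)} = (\<Prod>i\<in>A. if i \<in> S then spin (w (P i)) else 1)"
    if "S \<subseteq> A" for S w and P :: "'a \<Rightarrow> 'b"
  proof -
    have "(\<Prod>i\<in>A. if i \<in> S then spin (w (P i)) else 1) = (\<Prod>i\<in>A \<inter> S. spin (w (P i)))"
      using assms(1) by (simp add: prod.inter_restrict)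
    also have "\<dots> = walsh S {i \<in> A. w (P i)}"
      unfolding walsh_def using that by (intro prod.cong) auto
    finally show ?thesis ..
  qed
  have "measure_pmf.expectation (Pi_pmf A d (\<lambda>_. q))
           (\<lambda>P. walsh S {i \<in> A. u (P i)} * walsh T {i \<in> A. v (P i)})
      = measure_pmf.expectation (Pi_pmf A d (\<lambda>_. q)) (\<lambda>P. \<Prod>i\<in>A. h i (P i))"
    using assms by (simp add: walsh h_def prod.distrib)
  also have "\<dots> = (\<Prod>i\<in>A. measure_pmf.expectation q (h i))"
    using assms(1) by (rule expectation_prod_Pi_pmf_bounded) (auto simp: h_def spin_def)
  also have "\<dots> = (\<Prod>i\<in>A. if i \<in> S \<longleftrightarrow> i \<in> T then if i \<in> S then r else 1 else 0)"
    by (intro prod.cong) (auto simp: h_def mean_u mean_v corr_uv)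
  also have "\<dots> = (if S = T then r ^ card S else 0)"
  proof (cases "S = T")
    case True
    then show ?thesis
      using assms by (simp add: Int_absorb1 flip: prod.inter_restrict)
  next
    case False
    then obtain i where "i \<in> A" "(i \<in> S) \<noteq> (i \<in> T)"
      using assms by blast
    then have "(\<Prod>i\<in>A. if i \<in> S \<longleftrightarrow> i \<in> T then if i \<in> S then r else 1 else 0) = 0"
      using assms(1) by (intro prod_zero) auto
    then show ?thesis using False by simp
  qed
  finally show ?thesis .
qed

text \<open>The noise stability formula: in the product of the two Walsh expansions only the
  diagonal terms survive.\<close>

lemma expectation_correlated:
  assumes "finite A"
  shows "measure_pmf.expectation (Pi_pmf A d (\<lambda>_. q))
           (\<lambda>P. f {i \<in> A. u (P i)} * g {i \<in> A. v (P i)})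
       = (\<Sum>S\<in>Pow A. fourier A f S * fourier A g S * r ^ card S)"
proof -
  let ?M = "Pi_pmf A d (\<lambda>_. q)"
  let ?w = "\<lambda>S T P. walsh S {i \<in> A. u (P i)} * walsh T {i \<in> A. v (P i)}"
  have int: "integrable (measure_pmf ?M) (?w S T)" for S T
    by (intro measure_pmf.integrable_const_bound[where B = 1])
       (auto simp: walsh_def abs_mult abs_prod spin_def intro!: mult_le_one prod_le_1 prod_nonneg)
  have "f {i \<in> A. u (P i)} * g {i \<in> A. v (P i)}
      = (\<Sum>S\<in>Pow A. \<Sum>T\<in>Pow A. fourier A f S * fourier A g T * ?w S T P)" for P
  proof -
    have "f {i \<in> A. u (P i)} * g {i \<in> A. v (P i)}
        = (\<Sum>S\<in>Pow A. fourier A f S * walsh S {i \<in> A. u (P i)})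
          * (\<Sum>T\<in>Pow A. fourier A g T * walsh T {i \<in> A. v (P i)})"
      using assms by (simp add: fourier_expansion)
    then show ?thesis by (simp add: sum_product mult_ac)
  qed
  then have "measure_pmf.expectation ?M (\<lambda>P. f {i \<in> A. u (P i)} * g {i \<in> A. v (P i)})
      = (\<Sum>S\<in>Pow A. \<Sum>T\<in>Pow A. fourier A f S * fourier A g T
           * measure_pmf.expectation ?M (?w S T))"
    by (simp only: Bochner_Integration.integral_sum Bochner_Integration.integrable_sum int
        integrable_mult_right integral_mult_right_zero)
  also have "\<dots> = (\<Sum>S\<in>Pow A. \<Sum>T\<in>Pow A.
      if S = T then fourier A f S * fourier A g S * r ^ card S else 0)"
    using assms by (intro sum.cong refl) (auto simp: expectation_walsh_mult)
  also have "\<dots> = (\<Sum>S\<in>Pow A. fourier A f S * fourier A g S * r ^ card S)"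
    using assms by (intro sum.cong refl) (simp add: sum.delta)
  finally show ?thesis .
qed

end

section \<open>Level-one weight of a transitively symmetric function\<close>

lemma fourier_singleton_equal:
  assumes "\<And>i j. i \<in> A \<Longrightarrow> j \<in> A \<Longrightarrow>
      \<exists>\<pi>. \<pi> permutes A \<and> \<pi> i = j \<and> (\<forall>X. X \<subseteq> A \<longrightarrow> f (\<pi> ` X) = f X)"
    and "i \<in> A" "j \<in> A"
  shows "fourier A f {i} = fourier A f {j}"
proof -
  obtain \<pi> where \<pi>: "\<pi> permutes A" "\<pi> i = j" "\<And>X. X \<subseteq> A \<Longrightarrow> f (\<pi> ` X) = f X"
    using assms by blast
  have inj: "inj \<pi>" using \<pi>(1) by (rule permutes_inj)
  have "bij_betw ((`) \<pi>) (Pow A) (Pow A)"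
    using \<pi>(1) by (intro bij_betw_Pow permutes_imp_bij)
  then have "(\<Sum>X\<in>Pow A. f X * walsh {j} X) = (\<Sum>X\<in>Pow A. f (\<pi> ` X) * walsh {j} (\<pi> ` X))"
    by (rule sum.reindex_bij_betw[symmetric])
  also have "\<dots> = (\<Sum>X\<in>Pow A. f X * walsh {i} X)"
    using \<pi>(2,3) inj by (intro sum.cong) (auto simp: walsh_def inj_image_mem_iff simp flip: \<pi>(2))
  finally show ?thesis by (simp add: fourier_def)
qed

text \<open>With a common level-one coefficient a, the average of \<open>f X * spin_sum A X\<close>
  is na. Hence |na| \<le> (35/36) sqrt n, and the weight na^2 is at most (35/36)^2.\<close>

lemma level_one_weight_le:
  assumes A: "finite A" "card A \<ge> 2"
    and sign: "\<And>X. X \<subseteq> A \<Longrightarrow> f X = 1 \<or> f X = -1"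
    and sym: "\<And>i j. i \<in> A \<Longrightarrow> j \<in> A \<Longrightarrow>
      \<exists>\<pi>. \<pi> permutes A \<and> \<pi> i = j \<and> (\<forall>X. X \<subseteq> A \<longrightarrow> f (\<pi> ` X) = f X)"
  shows "(\<Sum>i\<in>A. (fourier A f {i})\<^sup>2) \<le> 35/36"
proof -
  define n where "n = real (card A)"
  have n: "n \<ge> 2" using A by (simp add: n_def)
  obtain i where i: "i \<in> A" using A by fastforce
  define a where "a = fourier A f {i}"
  have a: "fourier A f {j} = a" if "j \<in> A" for j
    unfolding a_def using sym that i by (rule fourier_singleton_equal)
  have "n * a = (\<Sum>j\<in>A. fourier A f {j})"
    using a by (simp add: n_def)
  also have "\<dots> = (\<Sum>X\<in>Pow A. f X * spin_sum A X) / 2 ^ card A"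
    unfolding fourier_def sum_divide_distrib[symmetric]
    by (subst sum.swap) (simp add: walsh_def spin_sum_def sum_distrib_left)
  finally have na: "n * a = (\<Sum>X\<in>Pow A. f X * spin_sum A X) / 2 ^ card A" .
  have "(\<Sum>X\<in>Pow A. f X * spin_sum A X) \<le> 35/36 * sqrt n * 2 ^ card A"
    unfolding n_def using A sign by (rule correlation_spin_sum_le)
  then have "n * a \<le> 35/36 * sqrt n"
    unfolding na by (simp add: pos_divide_le_eq)
  \<comment> \<open>The correlation bound is one-sided; applying it to -f as well bounds the
    absolute value.\<close>
  moreover have "(\<Sum>X\<in>Pow A. - f X * spin_sum A X) \<le> 35/36 * sqrt n * 2 ^ card A"
    unfolding n_def using A
  proof (rule correlation_spin_sum_le)
    show "- f X = 1 \<or> - f X = -1" if "X \<subseteq> A" for X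
      using sign[OF that] by auto
  qed
  then have "- (n * a) \<le> 35/36 * sqrt n"
    unfolding na by (simp add: sum_negf field_simps)
  ultimately have "\<bar>n * a\<bar> \<le> 35/36 * sqrt n" by linarith
  then have "(n * a)\<^sup>2 \<le> (35/36 * sqrt n)\<^sup>2"
    by (metis abs_ge_zero power2_abs power_mono)
  also have "\<dots> = n * (35/36)\<^sup>2"
    using n unfolding power_mult_distrib by simp
  finally have "n * (n * a\<^sup>2) \<le> n * (35/36)\<^sup>2"
    by (simp only: power2_eq_square mult.assoc mult.left_commute)
  then have "n * a\<^sup>2 \<le> (35/36)\<^sup>2" using n by simp
  also have "\<dots> \<le> 35/36" by (simp add: power2_eq_square)
  finally show ?thesis using a by (simp add: n_def)
qed

text \<open>Weight at least 1/36 lies off level one, where the multiplier is at least half the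
  product of 1 + r, 1 + s and 1 + t; this gives 72 = 36 * 2. On level one the multiplier is
  0.\<close>

lemma noise_stability_sum_ge:
  assumes A: "finite A" "card A \<ge> 2"
    and sign: "\<And>X. X \<subseteq> A \<Longrightarrow> f X = 1 \<or> f X = -1"
    and sym: "\<And>i j. i \<in> A \<Longrightarrow> j \<in> A \<Longrightarrow>
      \<exists>\<pi>. \<pi> permutes A \<and> \<pi> i = j \<and> (\<forall>X. X \<subseteq> A \<longrightarrow> f (\<pi> ` X) = f X)"
    and r: "\<bar>r\<bar> \<le> 1" "\<bar>s\<bar> \<le> 1" "\<bar>t\<bar> \<le> 1" "r + s + t = (- 1 :: real)"
  shows "(1 + r) * (1 + s) * (1 + t) / 72
      \<le> (\<Sum>S\<in>Pow A. (fourier A f S)\<^sup>2 * (1 + r ^ card S + s ^ card S + t ^ card S))"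
proof -
  define \<delta> where "\<delta> = (1 + r) * (1 + s) * (1 + t) / 2"
  have \<delta>: "\<delta> \<ge> 0" unfolding \<delta>_def using r by (intro divide_nonneg_pos mult_nonneg_nonneg) auto
  let ?L = "(\<lambda>i. {i}) ` A"
  have "(\<Sum>S\<in>Pow A. (fourier A f S)\<^sup>2) = 1"
    using A(1) sign by (rule parseval_sign)
  moreover have "(\<Sum>S\<in>Pow A. (fourier A f S)\<^sup>2)
      = (\<Sum>S\<in>Pow A - ?L. (fourier A f S)\<^sup>2) + (\<Sum>S\<in>?L. (fourier A f S)\<^sup>2)"
    using A(1) by (intro sum.subset_diff) auto
  moreover have "(\<Sum>S\<in>?L. (fourier A f S)\<^sup>2) = (\<Sum>i\<in>A. (fourier A f {i})\<^sup>2)"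
    by (simp add: sum.reindex)
  ultimately have "1/36 \<le> (\<Sum>S\<in>Pow A - ?L. (fourier A f S)\<^sup>2)"
    using level_one_weight_le[OF A sign sym] by simp
  then have "1/36 * \<delta> \<le> (\<Sum>S\<in>Pow A - ?L. (fourier A f S)\<^sup>2) * \<delta>"
    using \<delta> by (rule mult_right_mono)
  also have "\<dots> = (\<Sum>S\<in>Pow A - ?L. (fourier A f S)\<^sup>2 * \<delta>)"
    by (rule sum_distrib_right)
  also have "\<dots> \<le> (\<Sum>S\<in>Pow A - ?L. (fourier A f S)\<^sup>2 * (1 + r ^ card S + s ^ card S + t ^ card S))"
  proof (intro sum_mono mult_left_mono)
    fix S assume "S \<in> Pow A - ?L"
    then have "card S \<noteq> 1" by (auto simp: card_1_singleton_iff)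
    then show "\<delta> \<le> 1 + r ^ card S + s ^ card S + t ^ card S"
      unfolding \<delta>_def by (rule noise_multiplier_ge[OF r])
  qed simp
  also have "\<dots> = (\<Sum>S\<in>Pow A. (fourier A f S)\<^sup>2 * (1 + r ^ card S + s ^ card S + t ^ card S))"
  proof (rule sum.mono_neutral_left)
    have "1 + r + s + t = 0" using r(4) by simp
    then show "\<forall>S\<in>Pow A - (Pow A - ?L).
        (fourier A f S)\<^sup>2 * (1 + r ^ card S + s ^ card S + t ^ card S) = 0"
      by auto
  qed (use A in auto)
  finally show ?thesis by (simp add: \<delta>_def)
qed

section \<open>The voter distribution and the common choice function\<close>

lemma expectation_even_triple:
  fixes h :: "bool \<times> bool \<times> bool \<Rightarrow> real"
  assumes "\<alpha> \<ge> 0" "\<beta> \<ge> 0" "\<gamma> \<ge> 0" "\<alpha> + \<beta> + \<gamma> = 1/2"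
  shows "measure_pmf.expectation (even_triple_pmf \<alpha> \<beta> \<gamma>) h
       = \<alpha> * (h (True, True, False) + h (False, False, True))
       + \<beta> * (h (False, True, True) + h (True, False, False))
       + \<gamma> * (h (True, False, True) + h (False, True, False))"
proof -
  have "measure_pmf.expectation (even_triple_pmf \<alpha> \<beta> \<gamma>) h
      = (\<Sum>x\<in>UNIV. h x * pmf (even_triple_pmf \<alpha> \<beta> \<gamma>) x)"
    by (rule integral_measure_pmf_real) auto
  then show ?thesis
    unfolding even_triple_pmf_def pmf_pmf_of_list[OF even_triple_pmf_wf[OF assms]]
    by (simp add: UNIV_Times_UNIV[symmetric] UNIV_bool sum.cartesian_product[symmetric] algebra_simps
        del: UNIV_Times_UNIV)
qed

lemma mem_decode_iff [simp]:
  "(Alt_A, Alt_B) \<in> decode (x, y, z) \<longleftrightarrow> x"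
  "(Alt_B, Alt_C) \<in> decode (x, y, z) \<longleftrightarrow> y"
  "(Alt_C, Alt_A) \<in> decode (x, y, z) \<longleftrightarrow> z"
  by (auto simp: decode_def)

text \<open>A canonical profile in which exactly the voters in \<open>X\<close> prefer A to B: A > C
  > B on \<open>X\<close> and B > A > C off \<open>X\<close>. Opposite first and second bits keep
  the triple non-constant, so each ballot is a linear order.\<close>

definition profile_of :: "nat \<Rightarrow> nat set \<Rightarrow> nat \<Rightarrow> preference" where
  "profile_of n X = (\<lambda>i\<in>{1..n}. decode (i \<in> X, i \<notin> X, False))"

lemma profile_of_in_profiles: "profile_of n X \<in> profiles n"
  by (auto simp: profile_of_def profiles_def strict_linear_order_decode)

lemma mem_profile_of_iff: "i \<in> {1..n} \<Longrightarrow> (Alt_A, Alt_B) \<in> profile_of n X i \<longleftrightarrow> i \<in> X"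
  by (simp add: profile_of_def)

definition choice :: "nat \<Rightarrow> ((nat \<Rightarrow> preference) \<Rightarrow> preference) \<Rightarrow> nat set \<Rightarrow> real" where
  "choice n F X = spin ((Alt_A, Alt_B) \<in> F (profile_of n X))"

lemma mem_relabel_iff: "inj \<sigma> \<Longrightarrow> (\<sigma> a, \<sigma> b) \<in> relabel \<sigma> R \<longleftrightarrow> (a, b) \<in> R"
  by (auto simp: relabel_def inj_def)

lemma strict_linear_order_relabel:
  assumes "bij \<sigma>" "strict_linear_order R"
  shows "strict_linear_order (relabel \<sigma> R)"
proof -
  define \<tau> where "\<tau> = inv_into UNIV \<sigma>"
  have *: "(x, y) \<in> relabel \<sigma> R \<longleftrightarrow> (\<tau> x, \<tau> y) \<in> R" for x y
    using mem_relabel_iff[of \<sigma> "\<tau> x" "\<tau> y" R] assms(1)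
    by (simp add: \<tau>_def bij_is_inj bij_is_surj surj_f_inv_f)
  have "inj \<tau>" using assms(1) by (simp add: \<tau>_def bij_imp_bij_inv bij_is_inj)
  then show ?thesis
    using assms(2)
    unfolding strict_linear_order_on_def trans_def irrefl_def total_on_def * inj_def
    by blast
qed

text \<open>A canonical profile relabelled by \<sigma> agrees with \<open>P\<close> on the pair in
  question. IIA replaces \<open>P\<close> by it and neutrality undoes the relabelling, so one
  \<open>choice\<close> serves every ordered pair of distinct alternatives.\<close>

lemma spin_choice:
  assumes "IIA n F" "neutral n F" "bij \<sigma>" "P \<in> profiles n"
  shows "spin ((\<sigma> Alt_A, \<sigma> Alt_B) \<in> F P)
       = choice n F {i \<in> {1..n}. (\<sigma> Alt_A, \<sigma> Alt_B) \<in> P i}"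
proof -
  define X where "X = {i \<in> {1..n}. (\<sigma> Alt_A, \<sigma> Alt_B) \<in> P i}"
  define Q where "Q = (\<lambda>i\<in>{1..n}. relabel \<sigma> (profile_of n X i))"
  have inj: "inj \<sigma>" using assms(3) by (rule bij_is_inj)
  have "Q \<in> profiles n"
    using profile_of_in_profiles[of n X] strict_linear_order_relabel[OF assms(3)]
    by (auto simp: profiles_def Q_def)
  moreover have "(\<sigma> Alt_A, \<sigma> Alt_B) \<in> P i \<longleftrightarrow> (\<sigma> Alt_A, \<sigma> Alt_B) \<in> Q i" if "i \<in> {1..n}" for i
    using that by (simp add: Q_def mem_relabel_iff[OF inj] mem_profile_of_iff) (simp add: X_def)
  ultimately have "(\<sigma> Alt_A, \<sigma> Alt_B) \<in> F P \<longleftrightarrow> (\<sigma> Alt_A, \<sigma> Alt_B) \<in> F Q"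
    using assms(1,4) unfolding IIA_def by blast
  also have "F Q = relabel \<sigma> (F (profile_of n X))"
    using assms(2,3) profile_of_in_profiles unfolding neutral_def Q_def by blast
  finally show ?thesis
    by (simp add: mem_relabel_iff[OF inj] choice_def X_def)
qed

lemma choice_symmetric:
  assumes "IIA n F" "symmetric n F" "i \<in> {1..n}" "j \<in> {1..n}"
  shows "\<exists>\<pi>. \<pi> permutes {1..n} \<and> \<pi> i = j \<and>
           (\<forall>X. X \<subseteq> {1..n} \<longrightarrow> choice n F (\<pi> ` X) = choice n F X)"
proof -
  obtain G where G: "subgroup G (sym_group n)"
    "\<forall>i \<in> {1..n}. \<forall>j \<in> {1..n}. \<exists>\<pi> \<in> G. \<pi> i = j"
    "\<forall>\<pi> \<in> G. \<forall>P \<in> profiles n. F (P \<circ> \<pi>) = F P"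
    using assms(2) unfolding symmetric_def by blast
  obtain \<pi> where \<pi>: "\<pi> \<in> G" "\<pi> i = j" using G(2) assms(3,4) by blast
  have perm: "\<pi> permutes {1..n}"
    using subgroup.subset[OF G(1)] \<pi>(1) by (auto simp: sym_group_def)
  have "choice n F (\<pi> ` X) = choice n F X" for X
  proof -
    have "profile_of n (\<pi> ` X) \<circ> \<pi> = profile_of n X"
    proof
      fix k
      \<comment> \<open>For \<open>k\<close> outside \<open>{1..n}\<close> both sides are
        \<open>undefined\<close>, because \<pi> maps the complement of \<open>{1..n}\<close> to
        itself.\<close>
      show "(profile_of n (\<pi> ` X) \<circ> \<pi>) k = profile_of n X k"
        using permutes_in_image[OF perm, of k]
        by (simp add: profile_of_def inj_image_mem_iff[OF permutes_inj[OF perm]] restrict_def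
            del: atLeastAtMost_iff)
    qed
    then show ?thesis
      using G(3) \<pi>(1) profile_of_in_profiles[of n "\<pi> ` X"] unfolding choice_def by metis
  qed
  then show ?thesis using perm \<pi>(2) by blast
qed

section \<open>The probability of irrational choice\<close>

lemma prob_irrational_ge:
  fixes \<alpha> \<beta> \<gamma> :: real
  assumes pos: "\<alpha> \<ge> 0" "\<beta> \<ge> 0" "\<gamma> \<ge> 0" "\<alpha> + \<beta> + \<gamma> = 1/2"
    and n: "n \<ge> 2" and F: "IIA n F" "neutral n F" "symmetric n F"
  shows "2/9 * (\<alpha> * \<beta> * \<gamma>)
       \<le> measure_pmf.prob (even_product_pmf n \<alpha> \<beta> \<gamma>) {P. irrational (F P)}"
proof -
  define M where "M = even_product_pmf n \<alpha> \<beta> \<gamma>"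
  define q where "q = map_pmf decode (even_triple_pmf \<alpha> \<beta> \<gamma>)"
  define f where "f = choice n F"
  define A where "A = {1..n}"
  have A: "finite A" "card A \<ge> 2" using n by (simp_all add: A_def)
  let ?AB = "(Alt_A, Alt_B)" and ?BC = "(Alt_B, Alt_C)" and ?CA = "(Alt_C, Alt_A)"
  let ?X = "\<lambda>e P. f {i \<in> A. e \<in> P i}"
  have M: "M = Pi_pmf A undefined (\<lambda>_. q)"
    by (simp add: M_def q_def even_product_pmf_def A_def)
  have mean: "measure_pmf.expectation q (\<lambda>R. spin (e \<in> R)) = 0" if "e \<in> {?AB, ?BC, ?CA}" for e
    using that by (auto simp: q_def expectation_even_triple[OF pos])
  \<comment> \<open>Two bits that agree with probability 2\<alpha> have correlation 2\<alpha> - (1 -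
    2\<alpha>); likewise for \<beta> and \<gamma>.\<close>
  have corr:
    "measure_pmf.expectation q (\<lambda>R. spin (?AB \<in> R) * spin (?BC \<in> R)) = 4 * \<alpha> - 1"
    "measure_pmf.expectation q (\<lambda>R. spin (?BC \<in> R) * spin (?CA \<in> R)) = 4 * \<beta> - 1"
    "measure_pmf.expectation q (\<lambda>R. spin (?CA \<in> R) * spin (?AB \<in> R)) = 4 * \<gamma> - 1"
    using pos(4) by (simp_all add: q_def expectation_even_triple[OF pos])
  have stab:
    "measure_pmf.expectation M (\<lambda>P. ?X ?AB P * ?X ?BC P)
      = (\<Sum>S\<in>Pow A. (fourier A f S)\<^sup>2 * (4 * \<alpha> - 1) ^ card S)"
    "measure_pmf.expectation M (\<lambda>P. ?X ?BC P * ?X ?CA P)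
      = (\<Sum>S\<in>Pow A. (fourier A f S)\<^sup>2 * (4 * \<beta> - 1) ^ card S)"
    "measure_pmf.expectation M (\<lambda>P. ?X ?CA P * ?X ?AB P)
      = (\<Sum>S\<in>Pow A. (fourier A f S)\<^sup>2 * (4 * \<gamma> - 1) ^ card S)"
    unfolding M power2_eq_square
    by (rule expectation_correlated; simp add: mean corr A)+
  have sign: "f X = 1 \<or> f X = -1" for X
    by (simp add: f_def choice_def spin_def)
  have parseval: "(\<Sum>S\<in>Pow A. (fourier A f S)\<^sup>2) = 1"
    using A(1) sign by (rule parseval_sign)
  \<comment> \<open>For signs a, b, c the sum 1 + ab + bc + ca is 4 if all three agree and 0
    otherwise.\<close>
  have pointwise: "indicator {P. irrational (F P)} P
      = (1 + ?X ?AB P * ?X ?BC P + ?X ?BC P * ?X ?CA P + ?X ?CA P * ?X ?AB P) / 4"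
    if "P \<in> set_pmf M" for P
  proof -
    have P: "P \<in> profiles n" using that set_even_product_pmf[OF pos] by (auto simp: M_def)
    \<comment> \<open>The two cyclic shifts carry the pair (A, B) to (B, C) and to (C, A).\<close>
    define \<sigma> where "\<sigma> a = (case a of Alt_A \<Rightarrow> Alt_B | Alt_B \<Rightarrow> Alt_C | Alt_C \<Rightarrow> Alt_A)" for a
    define \<tau> where "\<tau> a = (case a of Alt_A \<Rightarrow> Alt_C | Alt_B \<Rightarrow> Alt_A | Alt_C \<Rightarrow> Alt_B)" for a
    have "bij \<sigma>" "bij \<tau>"
      by (rule o_bij[of \<tau>]; auto simp: \<sigma>_def \<tau>_def fun_eq_iff split: alternative.split)
         (rule o_bij[of \<sigma>]; auto simp: \<sigma>_def \<tau>_def fun_eq_iff split: alternative.split)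
    then have "?X ?AB P = spin (?AB \<in> F P)" "?X ?BC P = spin (?BC \<in> F P)"
        "?X ?CA P = spin (?CA \<in> F P)"
      using spin_choice[OF F(1,2) bij_id P] spin_choice[OF F(1,2) _ P, of \<sigma>]
        spin_choice[OF F(1,2) _ P, of \<tau>]
      by (simp_all add: f_def \<sigma>_def \<tau>_def A_def)
    then show ?thesis
      by (auto simp: irrational_def encode_def spin_def)
  qed
  have int: "integrable (measure_pmf M) (\<lambda>P. ?X d P * ?X e P)" for d e
    using sign by (intro measure_pmf.integrable_const_bound[where B = 1])
      (auto simp: abs_mult f_def choice_def spin_def)
  have "measure_pmf.prob M {P. irrational (F P)}
      = measure_pmf.expectation M (indicator {P. irrational (F P)})"
    by simp
  also have "\<dots> = measure_pmf.expectation M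
      (\<lambda>P. (1 + ?X ?AB P * ?X ?BC P + ?X ?BC P * ?X ?CA P + ?X ?CA P * ?X ?AB P) / 4)"
    by (intro integral_cong_AE) (auto simp: AE_measure_pmf_iff pointwise)
  also have "\<dots> = (1 + measure_pmf.expectation M (\<lambda>P. ?X ?AB P * ?X ?BC P)
      + measure_pmf.expectation M (\<lambda>P. ?X ?BC P * ?X ?CA P)
      + measure_pmf.expectation M (\<lambda>P. ?X ?CA P * ?X ?AB P)) / 4"
    by (simp add: int)
  also have "\<dots> = (\<Sum>S\<in>Pow A. (fourier A f S)\<^sup>2
      * (1 + (4 * \<alpha> - 1) ^ card S + (4 * \<beta> - 1) ^ card S + (4 * \<gamma> - 1) ^ card S)) / 4"
    unfolding stab by (simp add: distrib_left sum.distrib parseval)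
  \<comment> \<open>The numerator is 64 \<alpha> \<beta> \<gamma>, and 64 / (72 * 4) = 2/9.\<close>
  also have "\<dots> \<ge> (1 + (4 * \<alpha> - 1)) * (1 + (4 * \<beta> - 1)) * (1 + (4 * \<gamma> - 1)) / 72 / 4"
  proof (rule divide_right_mono[OF noise_stability_sum_ge[OF A sign]])
    show "\<exists>\<pi>. \<pi> permutes A \<and> \<pi> i = j \<and> (\<forall>X. X \<subseteq> A \<longrightarrow> f (\<pi> ` X) = f X)"
      if "i \<in> A" "j \<in> A" for i j
      using choice_symmetric[OF F(1,3)] that unfolding A_def f_def .
  qed (use pos in auto)
  finally show ?thesis by (simp add: M_def)
qed

theorem theorem1p1:
  fixes \<alpha> \<beta> \<gamma> :: real
  assumes "\<alpha> > 0" "\<beta> > 0" "\<gamma> > 0" "\<alpha> + \<beta> + \<gamma> = 1/2"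
  shows "\<exists>c>0. \<forall>(n::nat) (F :: (nat \<Rightarrow> preference) \<Rightarrow> preference).
           n \<ge> 2 \<longrightarrow> GSWF n F \<longrightarrow> IIA n F \<longrightarrow> neutral n F \<longrightarrow> symmetric n F \<longrightarrow>
           measure_pmf.prob (even_product_pmf n \<alpha> \<beta> \<gamma>) {P. irrational (F P)} > c"
proof (intro exI conjI allI impI)
  have pos: "0 < \<alpha> * \<beta> * \<gamma>" using assms by simp
  \<comment> \<open>Half of the bound in \<open>prob_irrational_ge\<close>, so that the final
    inequality is strict.\<close>
  then show "0 < 1/9 * (\<alpha> * \<beta> * \<gamma>)" by simp
  fix n :: nat and F :: "(nat \<Rightarrow> preference) \<Rightarrow> preference"
  assume "n \<ge> 2" "GSWF n F" "IIA n F" "neutral n F" "symmetric n F"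
  then have "2/9 * (\<alpha> * \<beta> * \<gamma>)
      \<le> measure_pmf.prob (even_product_pmf n \<alpha> \<beta> \<gamma>) {P. irrational (F P)}"
    using assms by (intro prob_irrational_ge) auto
  then show "1/9 * (\<alpha> * \<beta> * \<gamma>)
      < measure_pmf.prob (even_product_pmf n \<alpha> \<beta> \<gamma>) {P. irrational (F P)}"
    using pos by linarith
qed

end
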